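(* Let $r\ge 2$ be an integer and let $A$ be an $n\times n$ Hermitian matrix whose index set $[n]$ is partitioned into $r$ parts $N_1,\ldots,N_r$ so that, for every $i\in[r]$, the principal submatrix of $A$ indexed by $N_i$ (the diagonal block) is zero, i.e. $a_{jk}=0$ whenever $j,k\in N_i$ for some $i$. Then for every real diagonal $n\times n$ matrix $B$, \[ \mu\left(B-A\right)\geq\mu\left(B+\frac{1}{r-1}A\right). \]
   Context: For a Hermitian matrix $M$, its eigenvalues are written $\mu(M)=\mu_1(M)\ge\cdots\ge\mu_{\min}(M)$; so $\mu(M)$ denotes the largest eigenvalue of $M$. *)

theory Defs
  imports
    "Jordan_Normal_Form.Spectral_Radius"
    "Jordan_Normal_Form.Schur_Decomposition"
    "HOL-Library.Disjoint_Sets"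
begin

definition hermitian_mat :: "complex mat \<Rightarrow> bool" where
  "hermitian_mat A \<longleftrightarrow> mat_adjoint A = A"

(* Meant for Hermitian matrices of positive dimension: their eigenvalues are real,
   so Re only converts the type. The empty matrix has no eigenvalue, and there the
   value is the unspecified Max {}. *)
definition max_eigenvalue :: "complex mat \<Rightarrow> real" where
  "max_eigenvalue M = Max (Re ` spectrum M)"

definition real_diagonal_mat :: "complex mat \<Rightarrow> bool" where
  "real_diagonal_mat B \<longleftrightarrow> diagonal_mat B \<and> (\<forall>i<dim_row B. B $$ (i, i) \<in> \<real>)"

end

theory Submission
  imports Defs "HOL-Analysis.Function_Topology" "HOL-Analysis.Topology_Euclidean_Space"
begin

text \<open>Take a top eigenvector \<open>v\<close> of \<open>B + A / (r - 1)\<close>, let \<open>p i\<close> be the part containing the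
  index \<open>i\<close>, and use the \<open>r\<close> test vectors \<open>x\<^sub>k i = (\<delta>\<^bsub>p i, k\<^esub> - 1/r) v i\<close> in the Rayleigh bound
  for \<open>B - A\<close>. Summed over \<open>k\<close>, the coefficient products give \<open>1 - 1/r\<close> for two indices in the
  same part, where \<open>A\<close> vanishes, and \<open>- 1/r\<close> otherwise, where \<open>B\<close> vanishes. Hence the quadratic
  forms of \<open>B - A\<close> at the \<open>x\<^sub>k\<close> add up to \<open>1 - 1/r\<close> times that of \<open>B + A / (r - 1)\<close> at \<open>v\<close>,
  and the squared norms of the \<open>x\<^sub>k\<close> add up to \<open>1 - 1/r\<close> times that of \<open>v\<close>.\<close>

section \<open>Quadratic forms and their first variation\<close>

text \<open>Vectors are functions on all of \<open>nat\<close>, so that compactness in the product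
  topology is available; only the values below \<open>n\<close> enter the form.\<close>

definition quad_form :: "nat \<Rightarrow> (nat \<Rightarrow> nat \<Rightarrow> complex) \<Rightarrow> (nat \<Rightarrow> complex) \<Rightarrow> complex" where
  "quad_form n m x = (\<Sum>i<n. \<Sum>j<n. cnj (x i) * m i j * x j)"

lemma quad_form_eigen:
  assumes "\<And>i. i < n \<Longrightarrow> (\<Sum>j<n. m i j * x j) = k * x i"
  shows "quad_form n m x = k * of_real (\<Sum>i<n. (cmod (x i))\<^sup>2)"
proof -
  have "quad_form n m x = (\<Sum>i<n. cnj (x i) * (\<Sum>j<n. m i j * x j))"
    by (simp add: quad_form_def sum_distrib_left mult.assoc)
  also have "\<dots> = (\<Sum>i<n. k * of_real ((cmod (x i))\<^sup>2))"
    by (intro sum.cong refl) (simp add: assms complex_norm_square del: of_real_power)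
  finally show ?thesis by (simp add: sum_distrib_left)
qed

lemma quad_form_scale:
  "quad_form n m (\<lambda>i. of_real t * x i) = of_real (t\<^sup>2) * quad_form n m x"
  by (simp add: quad_form_def sum_distrib_left power2_eq_square mult_ac)

text \<open>By Hermitian symmetry the two cross terms are complex conjugates, so for real
  \<open>t\<close> they add up to twice a real part. The coefficient of \<open>t\<close> is the
  first variation of the form at \<open>x\<close> in direction \<open>y\<close>.\<close>

lemma quad_form_add_scaled:
  assumes herm: "\<And>i j. i < n \<Longrightarrow> j < n \<Longrightarrow> m j i = cnj (m i j)"
  shows "Re (quad_form n m (\<lambda>i. x i + of_real t * y i)) =
    Re (quad_form n m x) + 2 * t * Re (\<Sum>i<n. cnj (y i) * (\<Sum>j<n. m i j * x j))
      + t\<^sup>2 * Re (quad_form n m y)"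
proof -
  let ?S = "\<Sum>i<n. \<Sum>j<n. cnj (y i) * m i j * x j"
  let ?T = "\<Sum>i<n. \<Sum>j<n. cnj (x i) * m i j * y j"
  have "?T = (\<Sum>j<n. \<Sum>i<n. cnj (x i) * m i j * y j)"
    by (rule sum.swap)
  also have "\<dots> = cnj ?S"
    unfolding cnj_sum
    by (intro sum.cong refl) (simp add: herm[symmetric] mult_ac)
  finally have T: "?T = cnj ?S" .
  have "quad_form n m (\<lambda>i. x i + of_real t * y i) =
      (\<Sum>i<n. \<Sum>j<n. cnj (x i) * m i j * x j + of_real t * (cnj (y i) * m i j * x j)
        + of_real t * (cnj (x i) * m i j * y j)
        + of_real (t\<^sup>2) * (cnj (y i) * m i j * y j))"
    unfolding quad_form_def
    by (intro sum.cong refl) (simp add: algebra_simps power2_eq_square)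
  also have "\<dots> = quad_form n m x + of_real t * ?S + of_real t * ?T
      + of_real (t\<^sup>2) * quad_form n m y"
    by (simp add: quad_form_def sum.distrib sum_distrib_left)
  finally have expand: "quad_form n m (\<lambda>i. x i + of_real t * y i) = quad_form n m x + of_real t * ?S
      + of_real t * cnj ?S + of_real (t\<^sup>2) * quad_form n m y"
    unfolding T .
  have S: "?S = (\<Sum>i<n. cnj (y i) * (\<Sum>j<n. m i j * x j))"
    by (simp add: sum_distrib_left mult.assoc)
  have "Re (a + of_real t * s + of_real t * cnj s + of_real (t\<^sup>2) * b)
      = Re a + 2 * t * Re s + t\<^sup>2 * Re b" for a b s
    by (simp del: of_real_power)
  then show ?thesis unfolding expand S .
qed

text \<open>A zero of a positive semidefinite form is a minimum, so the first variation vanishes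
  there in every direction. In the direction of the image \<open>g\<close> of \<open>v\<close>
  itself, it is twice the squared norm of \<open>g\<close>.\<close>

lemma psd_quad_form_zero_imp_kernel:
  assumes herm: "\<And>i j. i < n \<Longrightarrow> j < n \<Longrightarrow> m j i = cnj (m i j)"
    and psd: "\<And>x. 0 \<le> Re (quad_form n m x)"
    and zero: "Re (quad_form n m v) = 0"
    and i: "i < n"
  shows "(\<Sum>j<n. m i j * v j) = 0"
proof -
  define g where "g i = (\<Sum>j<n. m i j * v j)" for i
  define S where "S = (\<Sum>i<n. (cmod (g i))\<^sup>2)"
  define Q where "Q = Re (quad_form n m g)"
  have Q: "Q \<ge> 0" unfolding Q_def by (rule psd)
  have "(\<Sum>i<n. cnj (g i) * (\<Sum>j<n. m i j * v j)) = of_real S"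
    by (simp add: S_def g_def[symmetric] complex_norm_square mult.commute[of "g _"] del: of_real_power)
  moreover have "Re (quad_form n m (\<lambda>i. v i + of_real t * g i)) = Re (quad_form n m v)
      + 2 * t * Re (\<Sum>i<n. cnj (g i) * (\<Sum>j<n. m i j * v j)) + t\<^sup>2 * Re (quad_form n m g)" for t
    by (rule quad_form_add_scaled) (rule herm)
  ultimately have ineq: "0 \<le> 2 * t * S + t\<^sup>2 * Q" for t
    using psd[of "\<lambda>i. v i + of_real t * g i"] zero by (simp add: Q_def)
  \<comment> \<open>At \<open>t = - u\<close> the right-hand side of \<open>ineq\<close> becomes
    \<open>- u\<^sup>2 * (Q + 2)\<close>, which forces \<open>u = 0\<close>. The summand 1 keeps the
    denominator positive when \<open>Q = 0\<close>.\<close>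
  define u where "u = S / (Q + 1)"
  have S: "S = u * (Q + 1)"
    using Q by (simp add: u_def)
  have "u\<^sup>2 * (Q + 2) \<le> 0"
    using ineq[of "- u"] by (simp add: S algebra_simps power2_eq_square)
  then have "u\<^sup>2 \<le> 0"
    using Q by (simp add: mult_le_0_iff)
  then have "S = 0"
    using S by simp
  then have "g i = 0"
    using i unfolding S_def by (subst (asm) sum_nonneg_eq_0_iff) auto
  then show ?thesis by (simp add: g_def)
qed

section \<open>A top eigenvector from maximization over the unit sphere\<close>

lemma quad_form_attains_max_on_sphere:
  assumes "n > 0"
  obtains v where "(\<Sum>i<n. (cmod (v i))\<^sup>2) = 1"
    and "\<And>x. (\<Sum>i<n. (cmod (x i))\<^sup>2) = 1 \<Longrightarrow> Re (quad_form n m x) \<le> Re (quad_form n m v)"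
proof -
  \<comment> \<open>The sphere condition leaves the coordinates from \<open>n\<close> on unbounded.
    Confining every coordinate to the closed unit disc makes the set compact by Tychonoff's
    theorem.\<close>
  define K :: "(nat \<Rightarrow> complex) set" where
    "K = Pi\<^sub>E UNIV (\<lambda>i. cball 0 1) \<inter> {x. (\<Sum>i<n. (cmod (x i))\<^sup>2) = 1}"
  have "closed {x :: nat \<Rightarrow> complex. (\<Sum>i<n. (cmod (x i))\<^sup>2) = 1}"
    by (intro closed_Collect_eq continuous_intros continuous_on_product_coordinates)
  moreover have "compact (Pi\<^sub>E UNIV (\<lambda>i :: nat. cball (0 :: complex) 1))"
    using compactin_PiE[of "\<lambda>_. euclidean" UNIV "\<lambda>_ :: nat. cball (0 :: complex) 1"]
    by (simp add: euclidean_product_topology)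
  ultimately have comp: "compact K"
    unfolding K_def by (rule compact_Int_closed[rotated])
  have "(\<lambda>i. if i = 0 then 1 else 0) \<in> K"
    using assms by (auto simp: K_def if_distrib[of "\<lambda>c. (cmod c)\<^sup>2"] cong: if_cong)
  then have ne: "K \<noteq> {}" by blast
  have "continuous_on K (\<lambda>x. Re (quad_form n m x))"
    unfolding quad_form_def
    by (intro continuous_intros continuous_on_subset[OF continuous_on_product_coordinates]) auto
  from continuous_attains_sup[OF comp ne this]
  obtain v where v: "v \<in> K" and max: "\<And>x. x \<in> K \<Longrightarrow> Re (quad_form n m x) \<le> Re (quad_form n m v)"
    by blast
  show thesis
  proof
    show "(\<Sum>i<n. (cmod (v i))\<^sup>2) = 1" using v by (simp add: K_def)
  next
    fix x :: "nat \<Rightarrow> complex"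
    assume x: "(\<Sum>i<n. (cmod (x i))\<^sup>2) = 1"
    \<comment> \<open>A point \<open>x\<close> of the sphere may leave the unit disc at indices from
      \<open>n\<close> on; truncation puts it into \<open>K\<close> without changing the
      form.\<close>
    define y where "y i = (if i < n then x i else 0)" for i
    have "cmod (x i) \<le> 1" if "i < n" for i
    proof -
      have "(cmod (x i))\<^sup>2 \<le> (\<Sum>i<n. (cmod (x i))\<^sup>2)"
        by (rule member_le_sum) (use that in auto)
      then show ?thesis unfolding x by (simp add: abs_square_le_1)
    qed
    then have "y \<in> K" using x by (auto simp: K_def y_def)
    moreover have "quad_form n m y = quad_form n m x" by (simp add: quad_form_def y_def)
    ultimately show "Re (quad_form n m x) \<le> Re (quad_form n m v)" using max by metis
  qed
qed

text \<open>Let \<open>l\<close> be the maximum of the form on the unit sphere, attained at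
  \<open>v\<close>. By homogeneity the form of \<open>l\<close> times the identity minus
  \<open>m\<close>, called \<open>h\<close> below, is positive semidefinite, and it vanishes at
  \<open>v\<close>; hence \<open>v\<close> lies in the kernel of \<open>h\<close>.\<close>

lemma hermitian_top_eigenvector:
  assumes "n > 0"
    and herm: "\<And>i j. i < n \<Longrightarrow> j < n \<Longrightarrow> m j i = cnj (m i j)"
  obtains l v where "\<exists>i<n. v i \<noteq> 0"
    and "\<And>i. i < n \<Longrightarrow> (\<Sum>j<n. m i j * v j) = of_real l * v i"
    and "\<And>x. Re (quad_form n m x) \<le> l * (\<Sum>i<n. (cmod (x i))\<^sup>2)"
proof -
  obtain v where v1: "(\<Sum>i<n. (cmod (v i))\<^sup>2) = 1"
    and vmax: "\<And>x. (\<Sum>i<n. (cmod (x i))\<^sup>2) = 1 \<Longrightarrow> Re (quad_form n m x) \<le> Re (quad_form n m v)"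
    using quad_form_attains_max_on_sphere[OF assms(1)] by blast
  define l where "l = Re (quad_form n m v)"
  define h where "h i j = (if i = j then of_real l else 0) - m i j" for i j
  have bound: "Re (quad_form n m x) \<le> l * (\<Sum>i<n. (cmod (x i))\<^sup>2)" for x
  proof (cases "(\<Sum>i<n. (cmod (x i))\<^sup>2) = 0")
    case True
    then have "x i = 0" if "i < n" for i
      using that by (subst (asm) sum_nonneg_eq_0_iff) auto
    then have "quad_form n m x = 0" by (simp add: quad_form_def)
    then show ?thesis by (simp only: True) simp
  next
    case False
    define s where "s = (\<Sum>i<n. (cmod (x i))\<^sup>2)"
    have s: "s > 0" using False unfolding s_def by (simp add: less_le sum_nonneg)
    let ?t = "1 / sqrt s"
    have t: "?t\<^sup>2 = 1 / s" using s by (simp add: power_divide)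
    have "(\<Sum>i<n. (cmod (of_real ?t * x i))\<^sup>2) = ?t\<^sup>2 * (\<Sum>i<n. (cmod (x i))\<^sup>2)"
      unfolding norm_mult norm_of_real power_mult_distrib power2_abs sum_distrib_left ..
    then have "(\<Sum>i<n. (cmod (of_real ?t * x i))\<^sup>2) = 1" using t s by (simp only: s_def[symmetric]) simp
    from vmax[OF this] have "?t\<^sup>2 * Re (quad_form n m x) \<le> l"
      unfolding quad_form_scale l_def by (simp del: of_real_divide of_real_power)
    then show ?thesis unfolding t s_def[symmetric] using s by (simp add: field_simps)
  qed
  have h_form: "Re (quad_form n h x) = l * (\<Sum>i<n. (cmod (x i))\<^sup>2) - Re (quad_form n m x)" for x
  proof -
    have "quad_form n h x = quad_form n (\<lambda>i j. if i = j then of_real l else 0) x - quad_form n m x"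
      by (simp add: quad_form_def h_def algebra_simps sum_subtractf)
    also have "quad_form n (\<lambda>i j. if i = j then of_real l else 0) x
        = of_real l * of_real (\<Sum>i<n. (cmod (x i))\<^sup>2)"
      by (rule quad_form_eigen) (simp add: if_distrib[of "\<lambda>c. c * _"] cong: if_cong)
    finally show ?thesis by simp
  qed
  have ker: "(\<Sum>j<n. h i j * v j) = 0" if "i < n" for i
  proof (rule psd_quad_form_zero_imp_kernel[OF _ _ _ that])
    show "h j i = cnj (h i j)" if "i < n" "j < n" for i j
      using herm[OF that] by (simp add: h_def)
    show "0 \<le> Re (quad_form n h x)" for x
      using bound[of x] by (simp add: h_form)
    show "Re (quad_form n h v) = 0"
      by (simp add: h_form v1 l_def)
  qed
  show thesis
  proof
    show "\<exists>i<n. v i \<noteq> 0"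
    proof (rule ccontr)
      assume "\<not> ?thesis"
      then have "(\<Sum>i<n. (cmod (v i))\<^sup>2) = 0" by simp
      with v1 show False by simp
    qed
    show "(\<Sum>j<n. m i j * v j) = of_real l * v i" if "i < n" for i
      using ker[OF that] that
      by (simp add: h_def algebra_simps sum_subtractf if_distrib[of "\<lambda>c. _ * c"] cong: if_cong)
    show "Re (quad_form n m x) \<le> l * (\<Sum>i<n. (cmod (x i))\<^sup>2)" for x
      by (rule bound)
  qed
qed

section \<open>Rayleigh quotients and \<open>max_eigenvalue\<close>\<close>

lemma mult_mat_vec_index_sum:
  assumes "M \<in> carrier_mat n n" "v \<in> carrier_vec n" "i < n"
  shows "vec_index (M *\<^sub>v v) i = (\<Sum>j<n. M $$ (i, j) * vec_index v j)"
  using assms by (simp add: scalar_prod_def lessThan_atLeast0)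

lemma hermitian_mat_entry:
  assumes "hermitian_mat M" "M \<in> carrier_mat n n" "i < n" "j < n"
  shows "M $$ (j, i) = cnj (M $$ (i, j))"
proof -
  have "M $$ (j, i) = mat_adjoint M $$ (j, i)"
    using assms(1) by (simp add: hermitian_mat_def)
  also have "\<dots> = cnj (M $$ (i, j))"
    using assms(2-) by (simp add: mat_adjoint_def mat_of_rows_index)
  finally show ?thesis .
qed

text \<open>The variational bound \<open>l\<close> is itself an eigenvalue, hence at most the
  maximum over the spectrum. This gives the Rayleigh bound without diagonalizing
  \<open>M\<close>.\<close>

lemma rayleigh_le_max_eigenvalue:
  assumes M: "M \<in> carrier_mat n n" and n: "n > 0"
    and herm: "\<And>i j. i < n \<Longrightarrow> j < n \<Longrightarrow> M $$ (j, i) = cnj (M $$ (i, j))"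
  shows "Re (quad_form n (\<lambda>i j. M $$ (i, j)) x) \<le> max_eigenvalue M * (\<Sum>i<n. (cmod (x i))\<^sup>2)"
proof -
  obtain l v where v0: "\<exists>i<n. v i \<noteq> 0"
    and ev: "\<And>i. i < n \<Longrightarrow> (\<Sum>j<n. M $$ (i, j) * v j) = of_real l * v i"
    and bound: "\<And>x. Re (quad_form n (\<lambda>i j. M $$ (i, j)) x) \<le> l * (\<Sum>i<n. (cmod (x i))\<^sup>2)"
    by (rule hermitian_top_eigenvector[of n "\<lambda>i j. M $$ (i, j)", OF n herm]) (assumption | rule that)+
  have "eigenvector M (Matrix.vec n v) (of_real l)"
    unfolding eigenvector_def
  proof (intro conjI)
    show "Matrix.vec n v \<in> carrier_vec (dim_row M)" using M by simp
    show "Matrix.vec n v \<noteq> 0\<^sub>v (dim_row M)"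
      using v0 M by (metis carrier_matD(1) index_vec index_zero_vec(1))
    show "M *\<^sub>v Matrix.vec n v = of_real l \<cdot>\<^sub>v Matrix.vec n v"
    proof (rule eq_vecI)
      fix i
      assume "i < dim_vec (of_real l \<cdot>\<^sub>v Matrix.vec n v)"
      then show "vec_index (M *\<^sub>v Matrix.vec n v) i = vec_index (of_real l \<cdot>\<^sub>v Matrix.vec n v) i"
        using ev[of i] by (simp add: mult_mat_vec_index_sum[OF M])
    qed (use M in simp)
  qed
  then have "of_real l \<in> spectrum M"
    by (auto simp: spectrum_def eigenvalue_def)
  then have "Re (of_real l) \<in> Re ` spectrum M" by (rule imageI)
  then have "l \<le> max_eigenvalue M"
    unfolding max_eigenvalue_def using card_finite_spectrum(1)[OF M] by (intro Max_ge) auto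
  then have "l * (\<Sum>i<n. (cmod (x i))\<^sup>2) \<le> max_eigenvalue M * (\<Sum>i<n. (cmod (x i))\<^sup>2)"
    by (intro mult_right_mono sum_nonneg) auto
  with bound[of x] show ?thesis by linarith
qed

text \<open>The spectrum is finite and nonempty, so some eigenvalue \<open>k\<close> has the maximal
  real part. The form at its eigenvector is \<open>k\<close> times the squared norm, and taking real
  parts gives the equation.\<close>

lemma max_eigenvalue_attained:
  assumes M: "M \<in> carrier_mat n n" and n: "n > 0"
  obtains v where "(\<Sum>i<n. (cmod (v i))\<^sup>2) > 0"
    and "Re (quad_form n (\<lambda>i j. M $$ (i, j)) v) = max_eigenvalue M * (\<Sum>i<n. (cmod (v i))\<^sup>2)"
proof -
  have "max_eigenvalue M \<in> Re ` spectrum M"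
    unfolding max_eigenvalue_def
    using card_finite_spectrum(1)[OF M] spectrum_non_empty[OF M n] by (intro Max_in) auto
  then obtain k w where k: "max_eigenvalue M = Re k" and "eigenvector M w k"
    by (auto simp: spectrum_def eigenvalue_def)
  then have w: "w \<in> carrier_vec n" "w \<noteq> 0\<^sub>v n" "M *\<^sub>v w = k \<cdot>\<^sub>v w"
    using M by (auto simp: eigenvector_def)
  have ev: "(\<Sum>j<n. M $$ (i, j) * vec_index w j) = k * vec_index w i" if "i < n" for i
    using mult_mat_vec_index_sum[OF M w(1) that] w that by simp
  have "\<exists>i<n. vec_index w i \<noteq> 0"
    using w(1,2) by (auto intro!: eq_vecI)
  then obtain i where i: "i < n" "vec_index w i \<noteq> 0" by blast
  show thesis
  proof
    show "(\<Sum>i<n. (cmod (vec_index w i))\<^sup>2) > 0"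
      by (rule sum_pos2[of _ i]) (use i in auto)
    show "Re (quad_form n (\<lambda>i j. M $$ (i, j)) (vec_index w))
        = max_eigenvalue M * (\<Sum>i<n. (cmod (vec_index w i))\<^sup>2)"
      by (subst quad_form_eigen[OF ev]) (simp_all add: k)
  qed
qed

section \<open>Simplex weights and the inequality\<close>

text \<open>The vectors \<open>(\<delta>\<^sub>s\<^sub>k - 1/r)\<^sub>k\<close> for \<open>s = 1, \<dots>, r\<close> are the vertices of a
  regular simplex centred at the origin; this is their Gram matrix.\<close>
lemma simplex_gram:
  fixes r s t :: nat
  assumes "s \<in> {1..r}" "t \<in> {1..r}"
  shows "(\<Sum>k=1..r. (of_bool (s = k) - 1 / real r) * (of_bool (t = k) - 1 / real r))
    = of_bool (s = t) - 1 / real r"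
proof -
  have r: "real r > 0" using assms by simp
  have "(\<Sum>k=1..r. (of_bool (s = k) - 1 / real r) * (of_bool (t = k) - 1 / real r))
    = (\<Sum>k=1..r. (if k = s then of_bool (s = t) else 0) - (if k = s then 1 / real r else 0)
        - (if k = t then 1 / real r else 0) + 1 / real r * (1 / real r))"
    by (intro sum.cong refl) (auto simp: algebra_simps)
  also have "\<dots> = of_bool (s = t) - 1 / real r - 1 / real r + real r * (1 / real r * (1 / real r))"
    using assms by (simp add: sum.distrib sum_subtractf)
  finally show ?thesis using r by simp
qed

theorem theorem1:
  fixes n r :: nat and A B :: "complex mat" and N :: "nat \<Rightarrow> nat set"
  assumes "r \<ge> 2"
    and "A \<in> carrier_mat n n" and "hermitian_mat A"
    and "(\<Union>i\<in>{1..r}. N i) = {0..<n}" and "disjoint_family_on N {1..r}"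
    and "\<And>i j k. i \<in> {1..r} \<Longrightarrow> j \<in> N i \<Longrightarrow> k \<in> N i \<Longrightarrow> A $$ (j, k) = 0"
    and "B \<in> carrier_mat n n" and "real_diagonal_mat B"
  shows "max_eigenvalue (B - A) \<ge> max_eigenvalue (B + (1 / (of_nat r - 1)) \<cdot>\<^sub>m A)"
proof (cases "n = 0")
  case True
  \<comment> \<open>For \<open>n = 0\<close> both sides are the same unspecified value
    \<open>Max {}\<close>.\<close>
  have "spectrum M = {}" if "M \<in> carrier_mat 0 0" for M :: "complex mat"
    using that by (auto simp: spectrum_def eigenvalue_def eigenvector_def)
  then have "spectrum (B - A) = {}" "spectrum (B + (1 / (of_nat r - 1)) \<cdot>\<^sub>m A) = {}"
    using assms(2,7) True by (blast intro: minus_carrier_mat add_carrier_mat smult_carrier_mat)+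
  then show ?thesis by (simp add: max_eigenvalue_def)
next
  case False
  then have n: "n > 0" by simp
  note A = assms(2) and B = assms(7)
  let ?C = "B + (1 / (of_nat r - 1)) \<cdot>\<^sub>m A"
  let ?D = "B - A"
  have C: "?C \<in> carrier_mat n n" and D: "?D \<in> carrier_mat n n"
    using A B by (blast intro: minus_carrier_mat add_carrier_mat smult_carrier_mat)+
  have B_off: "B $$ (i, j) = 0" if "i < n" "j < n" "i \<noteq> j" for i j
    using assms(8) B that by (auto simp: real_diagonal_mat_def diagonal_mat_def)
  have B_real: "cnj (B $$ (i, i)) = B $$ (i, i)" if "i < n" for i
    using assms(8) B that by (auto simp: real_diagonal_mat_def Reals_cnj_iff)
  have D_herm: "?D $$ (j, i) = cnj (?D $$ (i, j))" if "i < n" "j < n" for i j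
    using that A B B_real B_off hermitian_mat_entry[OF assms(3) A that]
    by (cases "i = j") auto
  have "\<forall>i. \<exists>k. i < n \<longrightarrow> k \<in> {1..r} \<and> i \<in> N k"
    using assms(4) by (metis UN_iff atLeastLessThan_iff zero_le)
  then obtain p where p: "\<And>i. i < n \<Longrightarrow> p i \<in> {1..r} \<and> i \<in> N (p i)" by metis
  have A_zero: "A $$ (i, j) = 0" if "i < n" "j < n" "p i = p j" for i j
    using assms(6)[of "p i" i j] p that by metis
  define c where "c k i = (of_bool (p i = k) - 1 / real r :: real)" for k i
  have gram: "(\<Sum>k=1..r. c k i * c k j) = of_bool (p i = p j) - 1 / real r" if "i < n" "j < n" for i j
    unfolding c_def by (rule simplex_gram) (use p that in auto)
  obtain v where v: "(\<Sum>i<n. (cmod (v i))\<^sup>2) > 0"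
    and vC: "Re (quad_form n (\<lambda>i j. ?C $$ (i, j)) v) = max_eigenvalue ?C * (\<Sum>i<n. (cmod (v i))\<^sup>2)"
    using max_eigenvalue_attained[OF C n] by blast
  define x where "x k i = of_real (c k i) * v i" for k i
  \<comment> \<open>Within a part \<open>A\<close> vanishes, and both sides are
    \<open>1 - 1/r\<close> times the entry of \<open>B\<close>. Across parts \<open>B\<close>
    vanishes, and both sides are the entry of \<open>A\<close> divided by \<open>r\<close>, since
    \<open>(1 - 1/r) / (r - 1) = 1/r\<close>; this is where the factor \<open>1/(r - 1)\<close>
    comes from.\<close>
  have entry: "?D $$ (i, j) * of_real (of_bool (p i = p j) - 1 / real r)
      = of_real (1 - 1 / real r) * ?C $$ (i, j)" if "i < n" "j < n" for i j
  proof -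
    have r: "complex_of_nat r - 1 \<noteq> 0" "complex_of_nat r \<noteq> 0"
      using assms(1) by (auto simp: of_nat_eq_1_iff)
    show ?thesis
      using that A B A_zero[OF that] B_off[OF that] r
      by (cases "p i = p j"; cases "i = j") (auto simp: field_simps)
  qed
  \<comment> \<open>The weights \<open>c k i\<close> are real, so conjugation only affects
    \<open>v\<close>; moving the sum over \<open>k\<close> innermost isolates the Gram
    entry.\<close>
  have "(\<Sum>k=1..r. quad_form n (\<lambda>i j. ?D $$ (i, j)) (x k))
      = (\<Sum>i<n. \<Sum>j<n. \<Sum>k=1..r. cnj (v i) * v j * (?D $$ (i, j) * of_real (c k i * c k j)))"
    unfolding quad_form_def x_def
    by (subst sum.swap, rule sum.cong[OF refl], subst sum.swap) (simp add: mult_ac)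
  also have "\<dots> = (\<Sum>i<n. \<Sum>j<n. cnj (v i) * v j *
      (?D $$ (i, j) * of_real (\<Sum>k=1..r. c k i * c k j)))"
    by (simp add: sum_distrib_left)
  also have "\<dots> = (\<Sum>i<n. \<Sum>j<n. cnj (v i) * v j * (of_real (1 - 1 / real r) * ?C $$ (i, j)))"
    by (intro sum.cong refl) (simp only: lessThan_iff gram entry)
  also have "\<dots> = of_real (1 - 1 / real r) * quad_form n (\<lambda>i j. ?C $$ (i, j)) v"
    unfolding quad_form_def sum_distrib_left by (simp only: mult_ac)
  finally have complex_forms: "(\<Sum>k=1..r. quad_form n (\<lambda>i j. ?D $$ (i, j)) (x k))
      = of_real (1 - 1 / real r) * quad_form n (\<lambda>i j. ?C $$ (i, j)) v" .
  have "Re (of_real a * z) = a * Re z" for a z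
    by simp
  with arg_cong[OF complex_forms, of Re]
  have forms: "(\<Sum>k=1..r. Re (quad_form n (\<lambda>i j. ?D $$ (i, j)) (x k)))
      = (1 - 1 / real r) * Re (quad_form n (\<lambda>i j. ?C $$ (i, j)) v)"
    by (simp only: Re_sum)
  \<comment> \<open>The squared norms need only the diagonal Gram entries, all equal to
    \<open>1 - 1/r\<close>.\<close>
  have "(\<Sum>k=1..r. \<Sum>i<n. (cmod (x k i))\<^sup>2) = (\<Sum>i<n. \<Sum>k=1..r. c k i * c k i * (cmod (v i))\<^sup>2)"
    by (subst sum.swap) (simp add: x_def norm_mult power_mult_distrib flip: power2_eq_square)
  also have "\<dots> = (\<Sum>i<n. (\<Sum>k=1..r. c k i * c k i) * (cmod (v i))\<^sup>2)"
    by (simp only: sum_distrib_right)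
  also have "\<dots> = (\<Sum>i<n. (1 - 1 / real r) * (cmod (v i))\<^sup>2)"
    by (intro sum.cong refl) (simp only: lessThan_iff gram, simp)
  finally have norms: "(\<Sum>k=1..r. \<Sum>i<n. (cmod (x k i))\<^sup>2) = (1 - 1 / real r) * (\<Sum>i<n. (cmod (v i))\<^sup>2)"
    by (simp only: sum_distrib_left)
  have "(\<Sum>k=1..r. Re (quad_form n (\<lambda>i j. ?D $$ (i, j)) (x k)))
      \<le> (\<Sum>k=1..r. max_eigenvalue ?D * (\<Sum>i<n. (cmod (x k i))\<^sup>2))"
    by (intro sum_mono rayleigh_le_max_eigenvalue[OF D n D_herm])
  then have "max_eigenvalue ?C * ((1 - 1 / real r) * (\<Sum>i<n. (cmod (v i))\<^sup>2))
      \<le> max_eigenvalue ?D * ((1 - 1 / real r) * (\<Sum>i<n. (cmod (v i))\<^sup>2))"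
    unfolding forms vC sum_distrib_left[symmetric] norms by (simp only: mult_ac)
  \<comment> \<open>As \<open>r \<ge> 2\<close> and \<open>v\<close> is nonzero, the common factor
    is positive and can be cancelled.\<close>
  moreover have "(1 - 1 / real r) * (\<Sum>i<n. (cmod (v i))\<^sup>2) > 0"
    using assms(1) v by (intro mult_pos_pos) auto
  ultimately show ?thesis by (rule mult_right_le_imp_le)
qed

end
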